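(* Let $\Gamma$ be a rectifiable Jordan curve, $X$ a Banach function space over $\Gamma$, and $w:\Gamma\to[0,\infty]$ a weight. (a) Let $t\in\Gamma$. If $w\in A_X(\Gamma,t)$ and $1\in A_X(\Gamma,t)$, then $\log w\in BMO(\Gamma,t)$. (b) If $w\in A_X(\Gamma)$ and $1\in A_X(\Gamma)$, then $\log w\in BMO(\Gamma)$.
   Context: A rectifiable Jordan curve $\Gamma\subset\mathbb{C}$ (homeomorphic to a circle) carries Lebesgue length measure $|d\tau|$; $|\Omega|$ is the measure of a measurable $\Omega\subset\Gamma$. For $t\in\Gamma$, $R>0$: $\Gamma(t,R)=\{\tau\in\Gamma:|\tau-t|<R\}$. A weight is a measurable $w:\Gamma\to[0,\infty]$ with $0<w<\infty$ a.e. Let $\mathcal{M}^+$ be the set of measurable functions $\Gamma\to[0,\infty]$. A map $\rho:\mathcal{M}^+\to[0,\infty]$ is a Banach function norm if for all $f,g,f_n\in\mathcal{M}^+$, $a\ge0$ and measurable $E\subset\Gamma$: (A1) $\rho(f)=0\Leftrightarrow f=0$ a.e., $\rho(af)=a\rho(f)$, $\rho(f+g)\le\rho(f)+\rho(g)$; (A2) $0\le g\le f$ a.e. implies $\rho(g)\le\rho(f)$; (A3) $0\le f_n\uparrow f$ a.e. implies $\rho(f_n)\uparrow\rho(f)$; (A4) $\rho(\chi_E)<\infty$; (A5) $\int_E f\,|d\tau|\le C_E\rho(f)$ with $C_E\in(0,\infty)$ independent of $f$. The Banach function space $X$ consists of all measurable complex $f$ (modulo null sets) with $\|f\|_X:=\rho(|f|)<\infty$.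 Its associate space $X'$ is the Banach function space generated by $\rho'(g)=\sup\{\int_\Gamma fg\,|d\tau|: f\in\mathcal{M}^+,\rho(f)\le1\}$. With $B_{t,R}(w)=\frac1R\|w\chi_{\Gamma(t,R)}\|_X\|\chi_{\Gamma(t,R)}/w\|_{X'}$: $A_X(\Gamma,t)$ is the class of weights with $\sup_{R>0}B_{t,R}(w)<\infty$, and $A_X(\Gamma)$ the class of weights with $\sup_{t\in\Gamma}\sup_{R>0}B_{t,R}(w)<\infty$. For $f:\Gamma\to[-\infty,\infty]$, $f\in L^1(\Gamma)$, let $\Omega_t(f,R)=\frac1{|\Gamma(t,R)|}\int_{\Gamma(t,R)}f\,|d\tau|$ and $\|f\|_{*,t}=\sup_{R>0}\frac1{|\Gamma(t,R)|}\int_{\Gamma(t,R)}|f(\tau)-\Omega_t(f,R)|\,|d\tau|$. $f\in BMO(\Gamma,t)$ means $\|f\|_{*,t}<\infty$; $f\in BMO(\Gamma)$ means $\sup_{t\in\Gamma}\|f\|_{*,t}<\infty$. *)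

theory Defs
  imports "HOL-Analysis.Analysis"
begin

text \<open>The length of \<open>g\<close> on \<open>[a, b]\<close>, as the supremum of the lengths of inscribed polygons;
  the lists are the (ordered) vertices' parameters. It is 0 if \<open>b < a\<close>.\<close>

definition curve_length :: "(real \<Rightarrow> 'a::metric_space) \<Rightarrow> real \<Rightarrow> real \<Rightarrow> ennreal" where
  "curve_length g a b =
     (SUP xs\<in>{xs. sorted xs \<and> set xs \<subseteq> {a..b}}.
        \<Sum>i<length xs - 1. ennreal (dist (g (xs ! i)) (g (xs ! Suc i))))"

text \<open>A rectifiable Jordan curve is given through a parametrization \<open>g\<close> by \<open>[0, 1]\<close>;
  as a point set it is \<open>path_image g\<close>.\<close>

definition rectifiable_jordan_curve :: "(real \<Rightarrow> complex) \<Rightarrow> bool" where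
  "rectifiable_jordan_curve g \<longleftrightarrow>
     simple_path g \<and> pathfinish g = pathstart g \<and> curve_length g 0 1 < \<infinity>"

text \<open>Lebesgue length measure on \<open>path_image g\<close>: the arc \<open>g ` {a..b}\<close> has measure
  \<open>curve_length g a b\<close>. It is the image under \<open>g\<close> of the Lebesgue--Stieltjes measure of the
  arc length function, completed so that the measurable subsets are the Lebesgue measurable ones.
  For a rectifiable Jordan curve the arc length function is finite and continuous (as
  \<open>interval_measure\<close> requires), and it is constant outside \<open>[0, 1]\<close>.\<close>

definition length_measure :: "(real \<Rightarrow> complex) \<Rightarrow> complex measure" where
  "length_measure g =
     completion (distr
       (restrict_space (interval_measure (\<lambda>s. enn2real (curve_length g 0 (min s 1)))) {0..1})
       (restrict_space borel (path_image g)) g)"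

text \<open>In what follows \<open>M\<close> is the length measure and \<open>space M\<close> is the curve. Functions on the
  curve are total functions on \<open>complex\<close>; their values off \<open>space M\<close> are irrelevant.\<close>

definition portion :: "complex measure \<Rightarrow> complex \<Rightarrow> real \<Rightarrow> complex set" where
  "portion M t R = {\<tau> \<in> space M. cmod (\<tau> - t) < R}"

definition weight :: "complex measure \<Rightarrow> (complex \<Rightarrow> ennreal) \<Rightarrow> bool" where
  "weight M w \<longleftrightarrow> w \<in> borel_measurable M \<and> (AE \<tau> in M. 0 < w \<tau> \<and> w \<tau> < \<infinity>)"

text \<open>\<open>\<rho>\<close> is only constrained on measurable functions. The last two conjuncts say that \<open>\<rho>\<close> is finite
  on characteristic functions and dominates the integral over each measurable set.\<close>

definition banach_function_norm ::
    "complex measure \<Rightarrow> ((complex \<Rightarrow> ennreal) \<Rightarrow> ennreal) \<Rightarrow> bool" where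
  "banach_function_norm M \<rho> \<longleftrightarrow>
     (\<forall>f\<in>borel_measurable M. \<rho> f = 0 \<longleftrightarrow> (AE \<tau> in M. f \<tau> = 0)) \<and>
     (\<forall>f\<in>borel_measurable M. \<forall>a::real. 0 \<le> a \<longrightarrow> \<rho> (\<lambda>\<tau>. ennreal a * f \<tau>) = ennreal a * \<rho> f) \<and>
     (\<forall>f\<in>borel_measurable M. \<forall>g\<in>borel_measurable M. \<rho> (\<lambda>\<tau>. f \<tau> + g \<tau>) \<le> \<rho> f + \<rho> g) \<and>
     (\<forall>f\<in>borel_measurable M. \<forall>g\<in>borel_measurable M.
        (AE \<tau> in M. g \<tau> \<le> f \<tau>) \<longrightarrow> \<rho> g \<le> \<rho> f) \<and>
     (\<forall>F f. (\<forall>n. F n \<in> borel_measurable M) \<longrightarrow> f \<in> borel_measurable M \<longrightarrow>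
        (AE \<tau> in M. incseq (\<lambda>n::nat. F n \<tau>) \<and> (\<lambda>n. F n \<tau>) \<longlonglongrightarrow> f \<tau>) \<longrightarrow>
        incseq (\<lambda>n. \<rho> (F n)) \<and> (\<lambda>n. \<rho> (F n)) \<longlonglongrightarrow> \<rho> f) \<and>
     (\<forall>E\<in>sets M. \<rho> (indicator E) < \<infinity>) \<and>
     (\<forall>E\<in>sets M. \<exists>C::real. 0 < C \<and>
        (\<forall>f\<in>borel_measurable M. (\<integral>\<^sup>+\<tau>\<in>E. f \<tau> \<partial>M) \<le> ennreal C * \<rho> f))"

definition associate_norm ::
    "complex measure \<Rightarrow> ((complex \<Rightarrow> ennreal) \<Rightarrow> ennreal) \<Rightarrow> (complex \<Rightarrow> ennreal) \<Rightarrow> ennreal" where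
  "associate_norm M \<rho> g =
     (SUP f\<in>{f \<in> borel_measurable M. \<rho> f \<le> 1}. \<integral>\<^sup>+\<tau>. f \<tau> * g \<tau> \<partial>M)"

text \<open>A Banach function space \<open>X\<close> is represented by the function norm \<open>\<rho>\<close> generating it:
  \<open>X\<close> is the space of measurable \<open>f\<close> with \<open>\<parallel>f\<parallel> = \<rho> \<bar>f\<bar>\<close> finite, so the norm of a function with
  values in \<open>[0, \<infinity>]\<close> is the value of \<open>\<rho>\<close>. For a weight neither norm below vanishes, so
  the convention \<open>0 * \<infinity> = 0\<close> plays no role in the product of the norms.\<close>

definition muckenhoupt_B ::
    "complex measure \<Rightarrow> ((complex \<Rightarrow> ennreal) \<Rightarrow> ennreal) \<Rightarrow> complex \<Rightarrow> real \<Rightarrow>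
     (complex \<Rightarrow> ennreal) \<Rightarrow> ennreal" where
  "muckenhoupt_B M \<rho> t R w =
     ennreal (1 / R) * \<rho> (\<lambda>\<tau>. w \<tau> * indicator (portion M t R) \<tau>)
       * associate_norm M \<rho> (\<lambda>\<tau>. indicator (portion M t R) \<tau> / w \<tau>)"

definition A_class_at ::
    "complex measure \<Rightarrow> ((complex \<Rightarrow> ennreal) \<Rightarrow> ennreal) \<Rightarrow> complex \<Rightarrow> (complex \<Rightarrow> ennreal) set" where
  "A_class_at M \<rho> t = {w. weight M w \<and> (SUP R\<in>{0<..}. muckenhoupt_B M \<rho> t R w) < \<infinity>}"

definition A_class ::
    "complex measure \<Rightarrow> ((complex \<Rightarrow> ennreal) \<Rightarrow> ennreal) \<Rightarrow> (complex \<Rightarrow> ennreal) set" where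
  "A_class M \<rho> =
     {w. weight M w \<and> (SUP t\<in>space M. SUP R\<in>{0<..}. muckenhoupt_B M \<rho> t R w) < \<infinity>}"

definition L1 :: "complex measure \<Rightarrow> (complex \<Rightarrow> ereal) set" where
  "L1 M = {f \<in> borel_measurable M. (\<integral>\<^sup>+\<tau>. e2ennreal \<bar>f \<tau>\<bar> \<partial>M) < \<infinity>}"

text \<open>For \<open>f \<in> L1 M\<close>, which is finite almost everywhere, \<open>real_of_ereal\<close> alters \<open>f\<close> only on a
  null set.\<close>

definition mean :: "complex measure \<Rightarrow> complex \<Rightarrow> (complex \<Rightarrow> ereal) \<Rightarrow> real \<Rightarrow> real" where
  "mean M t f R =
     1 / measure M (portion M t R) * (LINT \<tau>:portion M t R|M. real_of_ereal (f \<tau>))"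

definition bmo_seminorm_at :: "complex measure \<Rightarrow> complex \<Rightarrow> (complex \<Rightarrow> ereal) \<Rightarrow> ennreal" where
  "bmo_seminorm_at M t f =
     (SUP R\<in>{0<..}. (\<integral>\<^sup>+\<tau>\<in>portion M t R. e2ennreal \<bar>f \<tau> - ereal (mean M t f R)\<bar> \<partial>M)
        / emeasure M (portion M t R))"

definition BMO_at :: "complex measure \<Rightarrow> complex \<Rightarrow> (complex \<Rightarrow> ereal) set" where
  "BMO_at M t = {f \<in> L1 M. bmo_seminorm_at M t f < \<infinity>}"

definition BMO :: "complex measure \<Rightarrow> (complex \<Rightarrow> ereal) set" where
  "BMO M = {f \<in> L1 M. (SUP t\<in>space M. bmo_seminorm_at M t f) < \<infinity>}"

definition ln_ennreal :: "ennreal \<Rightarrow> ereal" where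
  "ln_ennreal x =
     (if x = 0 then - \<infinity> else if x = \<infinity> then \<infinity> else ereal (ln (enn2real x)))"

end

theory Submission
  imports Defs
begin

text \<open>An arc from \<open>t\<close> to a point at distance \<open>R\<close> has length at least \<open>R\<close>, so the measure of
  \<open>\<Gamma>(t, R)\<close> is at least \<open>R\<close> up to the radius at which the portion exhausts the curve. By
  Hoelder's inequality the product of the integrals of \<open>w\<close> and \<open>1 / w\<close> over \<open>\<Gamma>(t, R)\<close> is at most
  \<open>R\<^sup>2 B(w) B(1)\<close>, which makes \<open>w\<close> an \<open>A\<^sub>2\<close> weight in the averaged sense. If \<open>m\<close> is the mean of
  \<open>ln w\<close>, then \<open>1 + x \<le> exp x\<close> shows that the averages of \<open>e\<^sup>-\<^sup>m w\<close> and \<open>e\<^sup>m / w\<close> are both at least 1;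
  their product being bounded, both are bounded, and their sum dominates \<open>\<bar>ln w - m\<bar>\<close>.\<close>

section \<open>The norm of the associate space\<close>

context
  fixes M :: "complex measure" and \<rho> :: "(complex \<Rightarrow> ennreal) \<Rightarrow> ennreal"
  assumes norm: "banach_function_norm M \<rho>"
begin

lemma norm_eq_0_iff: "f \<in> borel_measurable M \<Longrightarrow> \<rho> f = 0 \<longleftrightarrow> (AE \<tau> in M. f \<tau> = 0)"
  using norm by (simp add: banach_function_norm_def)

lemma norm_scale: "f \<in> borel_measurable M \<Longrightarrow> 0 \<le> a \<Longrightarrow> \<rho> (\<lambda>\<tau>. ennreal a * f \<tau>) = ennreal a * \<rho> f"
  using norm by (simp add: banach_function_norm_def)

lemma norm_indicator_finite: "E \<in> sets M \<Longrightarrow> \<rho> (indicator E) < \<infinity>"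
  using norm by (simp add: banach_function_norm_def)

lemma le_associate_norm:
  "f \<in> borel_measurable M \<Longrightarrow> \<rho> f \<le> 1 \<Longrightarrow> (\<integral>\<^sup>+\<tau>. f \<tau> * g \<tau> \<partial>M) \<le> associate_norm M \<rho> g"
  unfolding associate_norm_def by (rule SUP_upper) simp

text \<open>Dividing \<open>f\<close> by \<open>c\<close> makes it admissible in the supremum that
  defines the associate norm. Asking only for an upper bound \<open>c > 0\<close> of
  \<open>\<rho> f\<close> keeps the quotient meaningful even if \<open>\<rho> f\<close> is
  0.\<close>

lemma scaled_le_associate_norm:
  assumes f: "f \<in> borel_measurable M" and g: "g \<in> borel_measurable M"
    and c: "0 < c" "\<rho> f \<le> ennreal c"
  shows "(\<integral>\<^sup>+\<tau>. f \<tau> * g \<tau> \<partial>M) \<le> ennreal c * associate_norm M \<rho> g"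
proof -
  have "\<rho> (\<lambda>\<tau>. ennreal (1 / c) * f \<tau>) = ennreal (1 / c) * \<rho> f"
    using f c by (intro norm_scale) auto
  also have "\<dots> \<le> ennreal (1 / c) * ennreal c"
    using c by (intro mult_left_mono) auto
  also have "\<dots> = 1"
    using c by (simp flip: ennreal_mult)
  finally have "(\<integral>\<^sup>+\<tau>. (ennreal (1 / c) * f \<tau>) * g \<tau> \<partial>M) \<le> associate_norm M \<rho> g"
    using f by (intro le_associate_norm) auto
  then have "ennreal c * (ennreal (1 / c) * (\<integral>\<^sup>+\<tau>. f \<tau> * g \<tau> \<partial>M)) \<le> ennreal c * associate_norm M \<rho> g"
    using f g by (simp add: nn_integral_cmult mult.assoc mult_left_mono)
  moreover have "ennreal c * ennreal (1 / c) = 1"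
    using c by (simp flip: ennreal_mult)
  ultimately show ?thesis
    by (simp flip: mult.assoc)
qed

text \<open>Scaling settles the case of a positive finite \<open>\<rho> f\<close>. The two products
  with a factor 0 need care, since 0 times infinity is 0: there one of \<open>f\<close>,
  \<open>g\<close> has to vanish almost everywhere.\<close>

lemma hoelder_associate_norm:
  assumes f: "f \<in> borel_measurable M" and g: "g \<in> borel_measurable M"
  shows "(\<integral>\<^sup>+\<tau>. f \<tau> * g \<tau> \<partial>M) \<le> \<rho> f * associate_norm M \<rho> g"
proof -
  consider "\<rho> f = 0" | "\<rho> f = \<infinity>" "associate_norm M \<rho> g = 0"
    | "\<rho> f = \<infinity>" "associate_norm M \<rho> g \<noteq> 0" | c where "0 < c" "\<rho> f = ennreal c"
    by (cases "\<rho> f") (auto simp: less_le infinity_ennreal_def)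
  then show ?thesis
  proof cases
    case 1
    then have "(\<integral>\<^sup>+\<tau>. f \<tau> * g \<tau> \<partial>M) = 0"
      using f g norm_eq_0_iff[OF f] by (simp add: nn_integral_0_iff_AE eventually_mono)
    then show ?thesis by simp
  next
    case 2
    \<comment> \<open>By (A4) the constant function 1 has finite norm, so testing the vanishing
      associate norm against it forces \<open>g\<close> to be 0 almost everywhere. The summand 1
      below makes the scaling constant positive.\<close>
    have fin: "\<rho> (indicator (space M)) < \<infinity>"
      by (rule norm_indicator_finite) simp
    have "(\<integral>\<^sup>+\<tau>. indicator (space M) \<tau> * g \<tau> \<partial>M)
        \<le> ennreal (enn2real (\<rho> (indicator (space M))) + 1) * associate_norm M \<rho> g"
      using fin g by (intro scaled_le_associate_norm) (auto simp: ennreal_plus add_increasing2 add_nonneg_pos)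
    then have "AE \<tau> in M. indicator (space M) \<tau> * g \<tau> = 0"
      using g 2 by (simp add: nn_integral_0_iff_AE)
    then have "AE \<tau> in M. f \<tau> * g \<tau> = 0"
      using AE_space by eventually_elim auto
    then have "(\<integral>\<^sup>+\<tau>. f \<tau> * g \<tau> \<partial>M) = 0"
      using f g by (simp add: nn_integral_0_iff_AE)
    then show ?thesis by simp
  next
    case 3
    then show ?thesis by (simp add: ennreal_top_mult)
  next
    case 4
    then show ?thesis using scaled_le_associate_norm[OF f g 4(1)] by simp
  qed
qed

text \<open>Hoelder's inequality is applied crosswise: the norm of \<open>w\<close> on the portion
  meets the associate norm of its indicator, and the norm of the indicator meets the associate norm
  of \<open>1 / w\<close>. Regrouped, the four factors form the two Muckenhoupt quantities, and
  their factors \<open>1 / R\<close> account for the square of \<open>R\<close>.\<close>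

lemma A2_product_le_muckenhoupt:
  assumes w: "w \<in> borel_measurable M" and P: "portion M t R \<in> sets M" and R: "0 < R"
  shows "(\<integral>\<^sup>+\<tau>\<in>portion M t R. w \<tau> \<partial>M) * (\<integral>\<^sup>+\<tau>\<in>portion M t R. 1 / w \<tau> \<partial>M)
    \<le> ennreal R ^ 2 * (muckenhoupt_B M \<rho> t R w * muckenhoupt_B M \<rho> t R (\<lambda>_. 1))"
proof -
  define P where "P = portion M t R"
  have [measurable]: "P \<in> sets M" "w \<in> borel_measurable M"
    using w P by (auto simp: P_def)
  let ?a = "\<rho> (\<lambda>\<tau>. w \<tau> * indicator P \<tau>)" and ?b = "associate_norm M \<rho> (\<lambda>\<tau>. indicator P \<tau> / w \<tau>)"
  let ?c = "\<rho> (\<lambda>\<tau>. 1 * indicator P \<tau>)" and ?d = "associate_norm M \<rho> (\<lambda>\<tau>. indicator P \<tau> / 1)"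
  have "(\<integral>\<^sup>+\<tau>\<in>P. w \<tau> \<partial>M) = (\<integral>\<^sup>+\<tau>. (w \<tau> * indicator P \<tau>) * (indicator P \<tau> / 1) \<partial>M)"
    by (intro nn_integral_cong) (auto simp: indicator_def)
  also have "\<dots> \<le> ?a * ?d"
    by (rule hoelder_associate_norm) measurable
  finally have 1: "(\<integral>\<^sup>+\<tau>\<in>P. w \<tau> \<partial>M) \<le> ?a * ?d" .
  have "(\<integral>\<^sup>+\<tau>\<in>P. 1 / w \<tau> \<partial>M) = (\<integral>\<^sup>+\<tau>. (1 * indicator P \<tau>) * (indicator P \<tau> / w \<tau>) \<partial>M)"
    by (intro nn_integral_cong) (auto simp: indicator_def)
  also have "\<dots> \<le> ?c * ?b"
    by (rule hoelder_associate_norm) measurable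
  finally have 2: "(\<integral>\<^sup>+\<tau>\<in>P. 1 / w \<tau> \<partial>M) \<le> ?c * ?b" .
  have cancel: "ennreal R * ennreal (1 / R) = 1"
    using R by (simp flip: ennreal_mult)
  have "(\<integral>\<^sup>+\<tau>\<in>P. w \<tau> \<partial>M) * (\<integral>\<^sup>+\<tau>\<in>P. 1 / w \<tau> \<partial>M) \<le> (?a * ?d) * (?c * ?b)"
    by (intro mult_mono 1 2) auto
  also have "\<dots> = (ennreal R * ennreal (1 / R)) * (ennreal R * ennreal (1 / R)) * ((?a * ?d) * (?c * ?b))"
    by (simp only: cancel mult_1_left)
  also have "\<dots> = ennreal R ^ 2 * ((ennreal (1 / R) * ?a * ?b) * (ennreal (1 / R) * ?c * ?d))"
    by (simp only: power2_eq_square mult_ac)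
  finally show ?thesis
    unfolding muckenhoupt_B_def P_def .
qed

end

section \<open>Mean oscillation of the logarithm of a weight\<close>

text \<open>At 0 and infinity both sides are 0, by the default values of
  \<open>real_of_ereal\<close>, \<open>enn2real\<close> and \<open>ln\<close>.\<close>

lemma real_of_ereal_ln_ennreal: "real_of_ereal (ln_ennreal x) = ln (enn2real x)"
  by (simp add: ln_ennreal_def)

lemma ln_ennreal_finite: "0 < x \<Longrightarrow> x < \<infinity> \<Longrightarrow> ln_ennreal x = ereal (ln (enn2real x))"
  by (auto simp: ln_ennreal_def)

lemma borel_measurable_ln_ennreal [measurable]: "ln_ennreal \<in> borel_measurable borel"
  unfolding ln_ennreal_def[abs_def] by measurable

text \<open>Two averages that are at least 1 and have product at most \<open>K\<close> are each at
  most \<open>K\<close>; their sum gives the constant \<open>2 * K\<close>. The second claim, for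
  \<open>P\<close> the whole curve, yields membership in \<open>L1\<close>.\<close>

lemma A2_mean_oscillation:
  fixes w :: "complex \<Rightarrow> ennreal" and M :: "complex measure"
  assumes w: "weight M w" and P: "P \<in> sets M"
    and pos: "0 < emeasure M P" and fin: "emeasure M P < \<infinity>" and K: "0 \<le> K"
    and A2: "(\<integral>\<^sup>+\<tau>\<in>P. w \<tau> \<partial>M) * (\<integral>\<^sup>+\<tau>\<in>P. 1 / w \<tau> \<partial>M) \<le> ennreal K * emeasure M P ^ 2"
    and m: "m = 1 / measure M P * (LINT \<tau>:P|M. ln (enn2real (w \<tau>)))"
  shows "(\<integral>\<^sup>+\<tau>\<in>P. e2ennreal \<bar>ln_ennreal (w \<tau>) - ereal m\<bar> \<partial>M) / emeasure M P \<le> ennreal (2 * K)"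
    and "(\<integral>\<^sup>+\<tau>\<in>P. e2ennreal \<bar>ln_ennreal (w \<tau>)\<bar> \<partial>M) < \<infinity>"
proof -
  have [measurable]: "w \<in> borel_measurable M" "P \<in> sets M"
    and w_pos: "AE \<tau> in M. 0 < w \<tau> \<and> w \<tau> < \<infinity>"
    using w P by (auto simp: weight_def)
  define u where "u \<tau> = ln (enn2real (w \<tau>))" for \<tau>
  define p where "p = measure M P"
  have [measurable]: "u \<in> borel_measurable M"
    unfolding u_def[abs_def] by measurable
  have p: "emeasure M P = ennreal p"
    unfolding p_def using fin by (intro emeasure_eq_ennreal_measure) auto
  have p_pos: "0 < p"
    using pos by (simp add: p)
  \<comment> \<open>Off the null set where \<open>w\<close> is 0 or infinite, everything is
    expressed through the real function \<open>u\<close>.\<close>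
  have w_eq: "AE \<tau> in M. w \<tau> = ennreal (exp (u \<tau>)) \<and> 1 / w \<tau> = ennreal (exp (- u \<tau>))
      \<and> ln_ennreal (w \<tau>) = ereal (u \<tau>)"
    using w_pos
  proof eventually_elim
    case (elim \<tau>)
    then have "exp (u \<tau>) = enn2real (w \<tau>)"
      by (simp add: u_def enn2real_positive_iff)
    with elim have w_exp: "w \<tau> = ennreal (exp (u \<tau>))"
      by simp
    have "1 / w \<tau> = ennreal (1 / exp (u \<tau>))"
      unfolding w_exp using divide_ennreal[of 1 "exp (u \<tau>)"] by simp
    moreover have "ln_ennreal (w \<tau>) = ereal (u \<tau>)"
      using elim by (simp add: ln_ennreal_finite u_def)
    ultimately show ?case
      using w_exp by (simp add: exp_minus inverse_eq_divide)
  qed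
  have I_eq: "(\<integral>\<^sup>+\<tau>\<in>P. w \<tau> \<partial>M) = (\<integral>\<^sup>+\<tau>. ennreal (indicator P \<tau> * exp (u \<tau>)) \<partial>M)"
    using w_eq by (intro nn_integral_cong_AE) (auto split: split_indicator)
  have J_eq: "(\<integral>\<^sup>+\<tau>\<in>P. 1 / w \<tau> \<partial>M) = (\<integral>\<^sup>+\<tau>. ennreal (indicator P \<tau> * exp (- u \<tau>)) \<partial>M)"
    using w_eq by (intro nn_integral_cong_AE) (auto split: split_indicator)
  \<comment> \<open>A finite product bounds both factors only if neither is 0; here the integrand is
    positive on a set of positive measure.\<close>
  have nz: "(\<integral>\<^sup>+\<tau>. ennreal (indicator P \<tau> * exp (v \<tau>)) \<partial>M) \<noteq> 0"
    if [measurable]: "v \<in> borel_measurable M" for v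
  proof
    assume "(\<integral>\<^sup>+\<tau>. ennreal (indicator P \<tau> * exp (v \<tau>)) \<partial>M) = 0"
    then have "AE \<tau> in M. ennreal (indicator P \<tau> * exp (v \<tau>)) = 0"
      by (subst (asm) nn_integral_0_iff_AE) auto
    then have "AE \<tau> in M. \<tau> \<notin> P"
      by eventually_elim (auto simp: indicator_def split: if_splits)
    then have "emeasure M P = 0"
      by (subst (asm) AE_iff_measurable[of P]) (auto dest: sets.sets_into_space[OF P, THEN subsetD])
    with pos show False by simp
  qed
  let ?I = "\<integral>\<^sup>+\<tau>. ennreal (indicator P \<tau> * exp (u \<tau>)) \<partial>M"
  let ?J = "\<integral>\<^sup>+\<tau>. ennreal (indicator P \<tau> * exp (- u \<tau>)) \<partial>M"
  have prod: "?I * ?J \<le> ennreal (K * p ^ 2)"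
    using A2 K p_pos by (simp add: I_eq J_eq p ennreal_mult ennreal_power)
  then have "?I * ?J < \<infinity>"
    by (rule le_less_trans) simp
  then have "?I < \<infinity>" "?J < \<infinity>"
    using nz[of u] nz[of "\<lambda>\<tau>. - u \<tau>"] by (auto simp: ennreal_mult_less_top)
  then have int_exp: "integrable M (\<lambda>\<tau>. indicator P \<tau> * exp (u \<tau>))"
      "integrable M (\<lambda>\<tau>. indicator P \<tau> * exp (- u \<tau>))"
    by (auto intro!: integrableI_nonneg)
  have int_P: "integrable M (indicator P :: complex \<Rightarrow> real)"
    using fin P by simp
  have abs_le: "\<bar>y\<bar> \<le> exp y + exp (- y)" for y :: real
    using exp_ge_add_one_self[of y] exp_ge_add_one_self[of "- y"]
    by (smt (verit) exp_gt_zero)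
  have int_u: "integrable M (\<lambda>\<tau>. indicator P \<tau> * u \<tau>)"
  proof (rule Bochner_Integration.integrable_bound)
    show "integrable M (\<lambda>\<tau>. indicator P \<tau> * exp (u \<tau>) + indicator P \<tau> * exp (- u \<tau>))"
      using int_exp by (rule Bochner_Integration.integrable_add)
    show "AE \<tau> in M. norm (indicator P \<tau> * u \<tau>) \<le> norm (indicator P \<tau> * exp (u \<tau>) + indicator P \<tau> * exp (- u \<tau>))"
      by (intro AE_I2) (use abs_le in \<open>auto simp: indicator_def abs_of_pos add_pos_pos\<close>)
  qed measurable
  define I J where "I = (LINT \<tau>|M. indicator P \<tau> * exp (u \<tau>))"
    and "J = (LINT \<tau>|M. indicator P \<tau> * exp (- u \<tau>))"
  have "?I = ennreal I" "?J = ennreal J"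
    unfolding I_def J_def using int_exp by (auto intro!: nn_integral_eq_integral)
  moreover have "0 \<le> I" "0 \<le> J"
    unfolding I_def J_def by (auto intro!: integral_nonneg)
  ultimately have IJ: "I * J \<le> K * p ^ 2"
    using prod K p_pos by (simp flip: ennreal_mult)
  have mp: "(LINT \<tau>|M. indicator P \<tau> * u \<tau>) = m * p"
    using p_pos by (simp add: m p_def set_lebesgue_integral_def u_def)
  \<comment> \<open>Integrate \<open>1 + (u - m) \<le> exp (u - m)\<close> over \<open>P\<close>:
    since \<open>m\<close> is the mean of \<open>u\<close>, the linear term integrates to 0 and
    \<open>p\<close> remains. The same is done below with \<open>m - u\<close>.\<close>
  have "p = (LINT \<tau>|M. indicator P \<tau> + indicator P \<tau> * u \<tau> - m * indicator P \<tau>)"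
    using int_P int_u P by (simp add: mp p_def)
  also have "\<dots> \<le> (LINT \<tau>|M. exp (- m) * (indicator P \<tau> * exp (u \<tau>)))"
  proof (rule integral_mono)
    show "indicator P \<tau> + indicator P \<tau> * u \<tau> - m * indicator P \<tau>
        \<le> exp (- m) * (indicator P \<tau> * exp (u \<tau>))" for \<tau>
      using exp_ge_add_one_self[of "u \<tau> - m"]
      by (simp add: exp_diff exp_minus field_class.field_divide_inverse mult.commute split: split_indicator)
  qed (use int_P int_u int_exp in simp_all)
  finally have pI: "p \<le> exp (- m) * I" by (simp add: I_def)
  have "p = (LINT \<tau>|M. indicator P \<tau> - indicator P \<tau> * u \<tau> + m * indicator P \<tau>)"
    using int_P int_u P by (simp add: mp p_def)
  also have "\<dots> \<le> (LINT \<tau>|M. exp m * (indicator P \<tau> * exp (- u \<tau>)))"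
  proof (rule integral_mono)
    show "indicator P \<tau> - indicator P \<tau> * u \<tau> + m * indicator P \<tau>
        \<le> exp m * (indicator P \<tau> * exp (- u \<tau>))" for \<tau>
      using exp_ge_add_one_self[of "m - u \<tau>"]
      by (simp add: exp_diff exp_minus field_class.field_divide_inverse mult.commute split: split_indicator)
  qed (use int_P int_u int_exp in simp_all)
  finally have pJ: "p \<le> exp m * J" by (simp add: J_def)
  have prod': "(exp (- m) * I) * (exp m * J) \<le> K * p * p"
    using IJ by (simp add: exp_minus power2_eq_square mult_ac)
  \<comment> \<open>In the product of the two factors, one factor at a time is replaced by its lower
    bound \<open>p\<close>.\<close>
  have "p * (exp (- m) * I) \<le> p * (K * p)" "p * (exp m * J) \<le> p * (K * p)"
    using prod' mult_right_mono[OF pI, of "exp m * J"] mult_left_mono[OF pJ, of "exp (- m) * I"]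
      \<open>0 \<le> I\<close> \<open>0 \<le> J\<close> by (simp_all add: mult_ac)
  then have bound: "exp (- m) * I + exp m * J \<le> 2 * K * p"
    using p_pos by (simp add: mult_le_cancel_left_pos)
  have "(\<integral>\<^sup>+\<tau>\<in>P. e2ennreal \<bar>ln_ennreal (w \<tau>) - ereal m\<bar> \<partial>M)
      \<le> (\<integral>\<^sup>+\<tau>. ennreal (exp (- m) * (indicator P \<tau> * exp (u \<tau>)) + exp m * (indicator P \<tau> * exp (- u \<tau>))) \<partial>M)"
  proof (intro nn_integral_mono_AE, use w_eq in eventually_elim)
    case (elim \<tau>)
    then show ?case
      using abs_le[of "u \<tau> - m"]
      by (auto simp: exp_diff exp_minus field_class.field_divide_inverse mult.commute
          simp del: ennreal_plus intro!: ennreal_leI split: split_indicator)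
  qed
  also have "\<dots> = ennreal (exp (- m) * I + exp m * J)"
    using int_exp by (subst nn_integral_eq_integral) (auto simp: I_def J_def)
  also have "\<dots> \<le> ennreal (2 * K) * ennreal p"
    using bound K p_pos by (simp flip: ennreal_mult add: ennreal_leI)
  finally show "(\<integral>\<^sup>+\<tau>\<in>P. e2ennreal \<bar>ln_ennreal (w \<tau>) - ereal m\<bar> \<partial>M) / emeasure M P \<le> ennreal (2 * K)"
    using p p_pos by (intro divide_le_posI_ennreal) (auto simp: mult.commute)
  have "(\<integral>\<^sup>+\<tau>\<in>P. e2ennreal \<bar>ln_ennreal (w \<tau>)\<bar> \<partial>M) = (\<integral>\<^sup>+\<tau>. ennreal (norm (indicator P \<tau> * u \<tau>)) \<partial>M)"
    using w_eq by (intro nn_integral_cong_AE) (auto simp: indicator_def)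
  also have "\<dots> < \<infinity>"
    using int_u by (simp add: integrable_iff_bounded)
  finally show "(\<integral>\<^sup>+\<tau>\<in>P. e2ennreal \<bar>ln_ennreal (w \<tau>)\<bar> \<partial>M) < \<infinity>" .
qed

section \<open>The length measure of a rectifiable Jordan curve\<close>

text \<open>The recursive form of the sum in \<open>curve_length\<close>, taken over the vertices
  themselves rather than their parameters, suits splitting and inserting by induction.\<close>

fun polygon_length :: "'a::metric_space list \<Rightarrow> real" where
  "polygon_length (x # y # zs) = dist x y + polygon_length (y # zs)"
| "polygon_length zs = 0"

lemma polygon_length_nonneg: "polygon_length xs \<ge> 0"
  by (induction xs rule: polygon_length.induct) auto

lemma polygon_length_eq_sum:
  "polygon_length xs = (\<Sum>i<length xs - 1. dist (xs ! i) (xs ! Suc i))"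
  by (induction xs rule: polygon_length.induct) (auto simp: sum.lessThan_Suc_shift simp del: sum.lessThan_Suc)

lemma polygon_length_split:
  "polygon_length (us @ x # vs) = polygon_length (us @ [x]) + polygon_length (x # vs)"
  by (induction us rule: polygon_length.induct) auto

text \<open>Between two vertices this is the triangle inequality; at an end the new vertex only adds
  an edge.\<close>

lemma polygon_length_insert: "polygon_length (us @ vs) \<le> polygon_length (us @ x # vs)"
proof (induction us)
  case Nil
  then show ?case by (cases vs) auto
next
  case (Cons a us)
  then show ?case
    by (cases us; cases vs) (auto simp: dist_triangle)
qed

lemma curve_length_eq:
  "curve_length g a b =
    (SUP xs\<in>{xs. sorted xs \<and> set xs \<subseteq> {a..b}}. ennreal (polygon_length (map g xs)))"
  unfolding curve_length_def polygon_length_eq_sum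
  by (intro SUP_cong refl) (simp add: sum_ennreal)

lemma polygon_length_le_curve_length:
  "sorted xs \<Longrightarrow> set xs \<subseteq> {a..b} \<Longrightarrow> ennreal (polygon_length (map g xs)) \<le> curve_length g a b"
  unfolding curve_length_eq by (rule SUP_upper) simp

text \<open>Polygons for the two pieces, joined through the vertex at \<open>x\<close>, form a
  polygon for the whole. The suprema over the two polygons are then taken one after the other, the
  empty list showing that their index sets are nonempty.\<close>

lemma curve_length_superadditive:
  assumes "a \<le> x" "x \<le> b"
  shows "curve_length g a x + curve_length g x b \<le> curve_length g a b"
proof -
  have "ennreal (polygon_length (map g us)) + ennreal (polygon_length (map g vs)) \<le> curve_length g a b"
    if "sorted us" "set us \<subseteq> {a..x}" "sorted vs" "set vs \<subseteq> {x..b}" for us vs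
  proof -
    have "polygon_length (map g us) + polygon_length (map g vs) \<le> polygon_length (map g (us @ x # vs))"
      using polygon_length_split[of "map g us" "g x" "map g vs"]
        polygon_length_insert[of "map g us" "[]" "g x"] polygon_length_insert[of "[]" "map g vs" "g x"]
      by simp
    moreover have "ennreal (polygon_length (map g (us @ x # vs))) \<le> curve_length g a b"
      using that assms by (intro polygon_length_le_curve_length) (fastforce simp: sorted_append)+
    ultimately show ?thesis
      by (metis ennreal_leI ennreal_plus order_trans polygon_length_nonneg)
  qed
  then have "ennreal (polygon_length (map g us)) + curve_length g x b \<le> curve_length g a b"
    if "sorted us" "set us \<subseteq> {a..x}" for us
    unfolding curve_length_eq[of g x b] using that
    by (subst ennreal_SUP_add_right) (auto intro!: SUP_least exI[of _ "[]"])
  then show ?thesis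
    unfolding curve_length_eq[of g a x]
    by (subst ennreal_SUP_add_left[symmetric]) (auto intro!: SUP_least exI[of _ "[]"])
qed

lemma dist_le_curve_length:
  assumes "a \<le> b" shows "ennreal (dist (g a) (g b)) \<le> curve_length g a b"
  using polygon_length_le_curve_length[of "[a,b]" a b g] assms by simp

text \<open>The gap between two consecutive vertices of a nearly optimal polygon starting at \<open>x\<close> can be
  shrunk by inserting a vertex close to \<open>x\<close>; no additivity of the length is needed.\<close>

lemma curve_length_right_approx:
  assumes fin: "curve_length g 0 1 < \<infinity>" and cont: "continuous_on {0..1} g"
    and x: "0 \<le> x" "x < 1" and e: "e > 0"
  shows "\<exists>y\<in>{x<..1}. curve_length g 0 y \<le> curve_length g 0 x + ennreal e"
proof -
  \<comment> \<open>One half of \<open>e\<close> pays for the near-optimality of the polygon, the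
    other for the edge from \<open>g x\<close> to \<open>g y\<close>.\<close>
  define d where "d = e / 2"
  have d: "d > 0" using e by (simp add: d_def)
  obtain xs where xs: "sorted xs" "set xs \<subseteq> {0..1}"
    and less: "curve_length g 0 1 \<le> ennreal (polygon_length (map g xs)) + ennreal d"
  proof (cases "curve_length g 0 1 = 0")
    case True then show ?thesis using that[of "[]"] by simp
  next
    case False
    then have "curve_length g 0 1 - ennreal d < curve_length g 0 1"
      using fin d by (intro ennreal_between) (auto simp: zero_less_iff_neq_zero)
    then obtain xs where "sorted xs" "set xs \<subseteq> {0..1}"
      "curve_length g 0 1 - ennreal d < ennreal (polygon_length (map g xs))"
      by (subst (asm) (2) curve_length_eq) (auto simp: less_SUP_iff)
    then show ?thesis using that[of xs] ennreal_minus_le_iff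
      by (metis add.commute less_imp_le ennreal_less_top top.not_eq_extremum)
  qed
  \<comment> \<open>The first vertex parameter beyond \<open>x\<close>, or 1 if there is
    none.\<close>
  define m where "m = Min (insert 1 {y\<in>set xs. x < y})"
  have m: "x < m" "m \<le> 1" using x by (auto simp: m_def)
  have gap: "m \<le> y" if "y \<in> set xs" "x < y" for y
    using that by (auto simp: m_def)
  have "\<exists>r>0. \<forall>y\<in>{0..1}. dist y x < r \<longrightarrow> dist (g y) (g x) < d"
    using cont x d by (auto simp: continuous_on_iff)
  then obtain r where r: "r > 0" "\<And>y. y \<in> {0..1} \<Longrightarrow> dist y x < r \<Longrightarrow> dist (g y) (g x) < d"
    by blast
  \<comment> \<open>Close enough to \<open>x\<close> for a short edge, and not beyond the next
    vertex, so that the list stays sorted.\<close>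
  define y where "y = min m (x + r / 2)"
  have y: "x < y" "y \<le> m" "y \<le> 1" using m r(1) by (auto simp: y_def)
  have dy: "dist (g x) (g y) \<le> d"
    using r(2)[of y] y x r(1) by (auto simp: dist_commute dist_real_def y_def min_def split: if_splits)
  define us vs where "us = filter (\<lambda>z. z \<le> x) xs" and "vs = filter (\<lambda>z. \<not> z \<le> x) xs"
  have uv: "xs = us @ vs"
    using xs(1) unfolding us_def vs_def
  proof (induction xs)
    case (Cons a xs)
    show ?case
    proof (cases "a \<le> x")
      case False
      with Cons.prems have "filter (\<lambda>z. z \<le> x) xs = []" "filter (\<lambda>z. \<not> z \<le> x) xs = xs"
        by (fastforce simp: filter_empty_conv intro!: filter_True)+
      then show ?thesis using False by simp
    qed (use Cons in auto)
  qed simp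
  have us: "sorted (us @ [x])" "set (us @ [x]) \<subseteq> {0..x}"
    using xs x by (auto simp: us_def sorted_append sorted_wrt_filter)
  have vs: "sorted (y # vs)" "set (y # vs) \<subseteq> {y..1}"
    using xs gap y by (fastforce simp: vs_def sorted_wrt_filter)+
  have "polygon_length (map g xs) \<le> polygon_length (map g us @ g x # g y # map g vs)"
    unfolding uv map_append
    using polygon_length_insert[of "map g us" "map g vs" "g y"]
      polygon_length_insert[of "map g us" "g y # map g vs" "g x"] by linarith
  also have "\<dots> = polygon_length (map g (us @ [x])) + dist (g x) (g y) + polygon_length (map g (y # vs))"
    by (subst polygon_length_split) simp
  also have "\<dots> \<le> polygon_length (map g (us @ [x])) + d + polygon_length (map g (y # vs))"
    using dy by simp
  finally have "ennreal (polygon_length (map g xs)) \<le>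
    ennreal (polygon_length (map g (us @ [x])) + d + polygon_length (map g (y # vs)))"
    by (rule ennreal_leI)
  also have "\<dots> = ennreal (polygon_length (map g (us @ [x]))) + ennreal d
      + ennreal (polygon_length (map g (y # vs)))"
    using d by (simp only: ennreal_plus polygon_length_nonneg add_nonneg_nonneg less_imp_le)
  also have "\<dots> \<le> curve_length g 0 x + ennreal d + curve_length g y 1"
    using us vs by (intro add_mono polygon_length_le_curve_length order_refl)
  finally have "curve_length g 0 1 \<le> curve_length g 0 x + ennreal d + curve_length g y 1 + ennreal d"
    using less by (meson add_right_mono order_trans)
  \<comment> \<open>Superadditivity at \<open>y\<close> puts the length of the remaining piece on
    both sides; being finite, it cancels.\<close>
  then have "curve_length g 0 y + curve_length g y 1 \<le> curve_length g 0 x + ennreal d + curve_length g y 1 + ennreal d"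
    using x y by (intro order_trans[OF curve_length_superadditive]) auto
  also have "\<dots> = (curve_length g 0 x + ennreal e) + curve_length g y 1"
    using d by (simp add: d_def add_ac flip: ennreal_plus)
  finally have *: "curve_length g 0 y + curve_length g y 1 \<le> (curve_length g 0 x + ennreal e) + curve_length g y 1" .
  have "curve_length g y 1 \<le> curve_length g 0 y + curve_length g y 1"
    by (simp add: add_increasing)
  also have "\<dots> \<le> curve_length g 0 1"
    using x y by (intro curve_length_superadditive) auto
  finally have "curve_length g y 1 \<le> curve_length g 0 1" .
  then have "curve_length g y 1 < top" using fin by auto
  with * have "curve_length g 0 y \<le> curve_length g 0 x + ennreal e"
    by (auto simp: add.commute[of _ "curve_length g y 1"] ennreal_add_left_cancel_le)
  with y show ?thesis by auto
qed

section \<open>The arc length function\<close>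

definition arc_length :: "(real \<Rightarrow> complex) \<Rightarrow> real \<Rightarrow> real" where
  "arc_length g s = enn2real (curve_length g 0 (min s 1))"

lemma curve_length_mono: "b \<le> c \<Longrightarrow> curve_length g a b \<le> curve_length g a c"
  unfolding curve_length_def by (intro SUP_subset_mono) auto

lemma curve_length_empty: "b < a \<Longrightarrow> curve_length g a b = 0"
  unfolding curve_length_def by (simp add: bot_ennreal)

context
  fixes g :: "real \<Rightarrow> complex"
  assumes jordan: "rectifiable_jordan_curve g"
begin

lemma continuous_on_param: "continuous_on {0..1} g"
  using jordan by (auto simp: rectifiable_jordan_curve_def simple_path_def path_def)

lemma ennreal_arc_length: "ennreal (arc_length g s) = curve_length g 0 (min s 1)"
proof -
  have "curve_length g 0 (min s 1) \<le> curve_length g 0 1"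
    by (intro curve_length_mono) simp
  also have "\<dots> < top"
    using jordan by (simp add: rectifiable_jordan_curve_def)
  finally show ?thesis
    by (simp add: arc_length_def)
qed

lemma arc_length_nonneg: "0 \<le> arc_length g s"
  by (simp add: arc_length_def)

lemma arc_length_mono: "s \<le> s' \<Longrightarrow> arc_length g s \<le> arc_length g s'"
  using curve_length_mono[of "min s 1" "min s' 1" g 0]
  by (simp add: arc_length_nonneg flip: ennreal_arc_length)

text \<open>By superadditivity the increment of arc length is at least the length of the piece in
  between, hence at least its chord.\<close>

lemma dist_le_arc_length:
  assumes "0 \<le> a" "a \<le> b" "b \<le> 1"
  shows "dist (g a) (g b) \<le> arc_length g b - arc_length g a"
proof -
  have "ennreal (arc_length g a + dist (g a) (g b)) = curve_length g 0 a + ennreal (dist (g a) (g b))"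
    using assms by (simp add: ennreal_arc_length arc_length_nonneg)
  also have "\<dots> \<le> curve_length g 0 a + curve_length g a b"
    using assms by (intro add_left_mono dist_le_curve_length)
  also have "\<dots> \<le> ennreal (arc_length g b)"
    using assms curve_length_superadditive[of 0 a b g] by (simp add: ennreal_arc_length)
  finally show ?thesis by (simp add: arc_length_nonneg flip: ennreal_plus)
qed

text \<open>Right continuity is what \<open>interval_measure\<close> demands of a distribution
  function. By monotonicity one small increment to the right suffices; to the left of 0 and from 1
  on the function is locally constant on that side.\<close>

lemma continuous_arc_length: "continuous (at_right a) (arc_length g)"
proof -
  have "\<exists>d>0. arc_length g (a + d) - arc_length g a < e" if e: "e > 0" for e
  proof -
    consider "a < 0" | "1 \<le> a" | "0 \<le> a" "a < 1" by linarith
    then show ?thesis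
    proof cases
      case 1
      then show ?thesis using e
        by (intro exI[of _ "- a / 2"]) (simp add: arc_length_def curve_length_empty)
    next
      case 2
      then show ?thesis using e
        by (intro exI[of _ 1]) (simp add: arc_length_def)
    next
      case 3
      obtain y where y: "a < y" "y \<le> 1"
        and le: "curve_length g 0 y \<le> curve_length g 0 a + ennreal (e / 2)"
        using curve_length_right_approx[OF _ continuous_on_param 3, of "e / 2"] jordan e
        by (auto simp: rectifiable_jordan_curve_def)
      have "ennreal (arc_length g y) \<le> ennreal (arc_length g a + e / 2)"
        using le y 3 e by (simp add: ennreal_arc_length arc_length_nonneg)
      then have "arc_length g y \<le> arc_length g a + e / 2"
        by (rule ennreal_le_iff[THEN iffD1, rotated]) (use e arc_length_nonneg in simp)
      then have "arc_length g y - arc_length g a < e"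
        using e by simp
      then show ?thesis
        using y by (intro exI[of _ "y - a"]) simp
    qed
  qed
  then show ?thesis
    by (subst continuous_at_right_real_increasing) (auto intro: arc_length_mono)
qed

section \<open>Length measure of Borel subsets of the curve\<close>

lemma emeasure_arc_Ioc:
  "a \<le> b \<Longrightarrow> emeasure (interval_measure (arc_length g)) {a<..b} = ennreal (arc_length g b - arc_length g a)"
  by (rule emeasure_interval_measure_Ioc) (auto intro: arc_length_mono continuous_arc_length)

lemma length_measure_eq:
  "length_measure g = completion (distr
      (restrict_space (interval_measure (arc_length g)) {0..1})
      (restrict_space borel (path_image g)) g)"
  unfolding length_measure_def arc_length_def[abs_def] ..

lemma space_length_measure: "space (length_measure g) = path_image g"
  by (simp add: length_measure_eq space_restrict_space)

lemma measurable_param: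
  "g \<in> restrict_space (interval_measure (arc_length g)) {0..1} \<rightarrow>\<^sub>M restrict_space borel (path_image g)"
proof -
  have "g \<in> restrict_space borel {0..1} \<rightarrow>\<^sub>M borel"
    by (rule borel_measurable_continuous_on_restrict[OF continuous_on_param])
  then have "g \<in> restrict_space (interval_measure (arc_length g)) {0..1} \<rightarrow>\<^sub>M borel"
    by (subst measurable_cong_sets[OF sets_restrict_space_cong[OF sets_interval_measure] refl])
  then show ?thesis
    by (rule measurable_restrict_space2[rotated]) (auto simp: path_image_def space_restrict_space)
qed

text \<open>Traces of Borel sets are measurable before the completion, so their measure is that of
  the preimage under the parametrization.\<close>

lemma emeasure_length_measure:
  assumes "B \<in> sets borel"
  shows "path_image g \<inter> B \<in> sets (length_measure g)"
    and "emeasure (length_measure g) (path_image g \<inter> B) =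
      emeasure (interval_measure (arc_length g)) (g -` B \<inter> {0..1})"
proof -
  have *: "path_image g \<inter> B \<in> sets (restrict_space borel (path_image g))"
    using assms by (auto simp: sets_restrict_space)
  then show "path_image g \<inter> B \<in> sets (length_measure g)"
    by (simp add: length_measure_eq)
  have "g -` (path_image g \<inter> B) \<inter> {0..1} = g -` B \<inter> {0..1}"
    by (auto simp: path_image_def)
  then show "emeasure (length_measure g) (path_image g \<inter> B) =
      emeasure (interval_measure (arc_length g)) (g -` B \<inter> {0..1})"
    using * by (simp add: length_measure_eq emeasure_distr[OF measurable_param *]
      space_restrict_space emeasure_restrict_space)
qed

lemma finite_length_measure: "finite_measure (length_measure g)"
proof
  have "emeasure (length_measure g) (space (length_measure g)) =
      emeasure (interval_measure (arc_length g)) {0..1}"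
    using emeasure_length_measure(2)[of UNIV] by (simp add: space_length_measure)
  also have "\<dots> \<le> emeasure (interval_measure (arc_length g)) {-1<..1}"
    by (intro emeasure_mono) auto
  also have "\<dots> < top"
    by (simp add: emeasure_arc_Ioc)
  finally show "emeasure (length_measure g) (space (length_measure g)) \<noteq> \<infinity>"
    by simp
qed

lemma portion_eq: "portion (length_measure g) t R = path_image g \<inter> ball t R"
  by (auto simp: portion_def space_length_measure dist_norm norm_minus_commute)

lemma portion_sets: "portion (length_measure g) t R \<in> sets (length_measure g)"
  unfolding portion_eq by (rule emeasure_length_measure) simp

section \<open>Portions and their radii\<close>

text \<open>Follow the curve from \<open>t\<close> towards \<open>z\<close> up to the parameter
  \<open>c\<close> where it first leaves the ball. The arc before \<open>c\<close> lies in the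
  portion, and its length is at least the chord from \<open>t\<close> to \<open>g c\<close>, hence
  at least \<open>R\<close>.\<close>

lemma emeasure_portion_ge:
  assumes "t \<in> path_image g" "z \<in> path_image g" "0 < R" "R \<le> dist t z"
  shows "ennreal R \<le> emeasure (length_measure g) (portion (length_measure g) t R)"
proof -
  let ?I = "interval_measure (arc_length g)"
  obtain a b where a: "a \<in> {0..1}" "t = g a" and b: "b \<in> {0..1}" "z = g b"
    using assms by (auto simp: path_image_def)
  have portion: "emeasure (length_measure g) (portion (length_measure g) t R)
      = emeasure ?I (g -` ball t R \<inter> {0..1})"
    unfolding portion_eq by (rule emeasure_length_measure) simp
  have meas: "g -` ball t R \<inter> {0..1} \<in> sets ?I"
    using measurable_sets[OF borel_measurable_continuous_on_restrict[OF continuous_on_param], of "ball t R"]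
    by (simp add: sets_restrict_space_iff space_restrict_space)
  have sub: "ennreal (dist (g u) (g v)) \<le> emeasure ?I (g -` ball t R \<inter> {0..1})"
    if "u \<in> {0..1}" "v \<in> {0..1}" "u \<le> v" "\<And>x. u < x \<Longrightarrow> x \<le> v \<Longrightarrow> dist t (g x) < R" for u v
  proof -
    have "ennreal (dist (g u) (g v)) \<le> emeasure ?I {u<..v}"
      using that by (simp add: emeasure_arc_Ioc dist_le_arc_length ennreal_leI)
    also have "\<dots> \<le> emeasure ?I (g -` ball t R \<inter> {0..1})"
      using that by (intro emeasure_mono meas) auto
    finally show ?thesis .
  qed
  have comp: "compact {x \<in> {u..v}. R \<le> dist t (g x)}" if "u \<in> {0..1}" "v \<in> {0..1}" for u v
  proof (rule compact_Int_closed[of "{u..v}" "{x \<in> {u..v}. R \<le> dist t (g x)}", THEN back_subst[of compact]])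
    show "closed {x \<in> {u..v}. R \<le> dist t (g x)}"
      using that by (intro continuous_closed_preimage_constant continuous_on_closed_Collect_le)
        (auto intro!: continuous_intros continuous_on_subset[OF continuous_on_param])
  qed auto
  have "a \<noteq> b" using assms a b by auto
  then consider "a < b" | "b < a" by linarith
  then show ?thesis
  proof cases
    case 1
    then have "{x \<in> {a..b}. R \<le> dist t (g x)} \<noteq> {}" using assms b by auto
    from compact_attains_inf[OF comp[OF a(1) b(1)] this] obtain c
      where c: "c \<in> {a..b}" "R \<le> dist t (g c)" and min: "\<And>x. x \<in> {a..b} \<Longrightarrow> R \<le> dist t (g x) \<Longrightarrow> c \<le> x"
      by auto
    have "a \<noteq> c" using c a assms by auto
    then have "a < c" using c by auto
    have c01: "c \<in> {0..1}" using a b c by auto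
    \<comment> \<open>The interval \<open>{a<..c}\<close> contains \<open>c\<close>, where the curve
      is outside the ball. So the estimate is made for \<open>x < c\<close>, and \<open>x\<close>
      then tends to \<open>c\<close> from the left.\<close>
    have le: "ennreal (dist t (g x)) \<le> emeasure ?I (g -` ball t R \<inter> {0..1})" if "a \<le> x" "x < c" for x
    proof -
      have "dist t (g y) < R" if "a < y" "y \<le> x" for y
        using min[of y] that \<open>x < c\<close> c by force
      then show ?thesis
        using sub[of a x] that a c01 by auto
    qed
    have "continuous_on {a..c} (\<lambda>x. ennreal (dist t (g x)))"
      using a c01 by (intro continuous_on_ennreal continuous_on_dist continuous_on_const
          continuous_on_subset[OF continuous_on_param]) auto
    then have "((\<lambda>x. ennreal (dist t (g x))) \<longlongrightarrow> ennreal (dist t (g c))) (at_left c)"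
      using \<open>a < c\<close> by (force simp: continuous_on_def simp flip: at_within_Icc_at_left simp del: tendsto_ennreal_iff)
    moreover have "eventually (\<lambda>x. ennreal (dist t (g x)) \<le> emeasure ?I (g -` ball t R \<inter> {0..1})) (at_left c)"
      using \<open>a < c\<close> le by (auto simp: eventually_at_left intro!: exI[of _ a])
    ultimately have "ennreal (dist t (g c)) \<le> emeasure ?I (g -` ball t R \<inter> {0..1})"
      by (rule tendsto_upperbound) simp
    then show ?thesis
      unfolding portion by (rule order_trans[OF ennreal_leI[OF c(2)]])
  next
    case 2
    then have "b \<in> {x \<in> {b..a}. R \<le> dist t (g x)}" using assms b by simp
    then have "{x \<in> {b..a}. R \<le> dist t (g x)} \<noteq> {}" by blast
    from compact_attains_sup[OF comp[OF b(1) a(1)] this] obtain c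
      where c: "c \<in> {b..a}" "R \<le> dist t (g c)" and max: "\<And>x. x \<in> {b..a} \<Longrightarrow> R \<le> dist t (g x) \<Longrightarrow> x \<le> c"
      by auto
    \<comment> \<open>In this direction \<open>{c<..a}\<close> already omits \<open>c\<close>, so no
      limit is taken.\<close>
    have "dist t (g x) < R" if "c < x" "x \<le> a" for x
      using max[of x] that c by force
    then have "ennreal (dist (g c) (g a)) \<le> emeasure ?I (g -` ball t R \<inter> {0..1})"
      using a b c by (intro sub) auto
    then show ?thesis
      unfolding portion dist_commute[of "g c"] a(2)[symmetric]
      by (rule order_trans[OF ennreal_leI[OF c(2)]])
  qed
qed

text \<open>Beyond the distance to the farthest point \<open>z\<close>, the portion is the whole
  curve and no longer grows with \<open>R\<close>. There the radius is replaced by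
  \<open>2 * dist t z\<close>; the factor 2 puts \<open>z\<close> inside the open ball.\<close>

lemma portion_comparable_radius:
  assumes t: "t \<in> path_image g" and "0 < R"
  obtains R' where "0 < R'" "portion (length_measure g) t R' = portion (length_measure g) t R"
    "ennreal R' \<le> 2 * emeasure (length_measure g) (portion (length_measure g) t R)"
proof -
  have "simple_path g" using jordan by (simp add: rectifiable_jordan_curve_def)
  then have "compact (path_image g)" by (simp add: compact_simple_path_image)
  from distance_attains_sup[OF this] t obtain z
    where z: "z \<in> path_image g" and far: "\<And>y. y \<in> path_image g \<Longrightarrow> dist t y \<le> dist t z"
    by blast
  \<comment> \<open>Two distinct points on the curve make the distance from \<open>t\<close> to the
    farthest point positive.\<close>
  have "g 0 \<noteq> g (1/2)"
    using \<open>simple_path g\<close> by (fastforce simp: simple_path_def loop_free_def)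
  moreover have "g 0 \<in> path_image g" "g (1/2) \<in> path_image g"
    by (auto simp: path_image_def)
  ultimately have pos: "0 < dist t z"
    using far by (metis dist_self dist_le_zero_iff not_less)
  show ?thesis
  proof (cases "R \<le> dist t z")
    case True
    have "ennreal R \<le> 1 * emeasure (length_measure g) (portion (length_measure g) t R)"
      using emeasure_portion_ge[OF t z \<open>0 < R\<close> True] by simp
    also have "\<dots> \<le> 2 * emeasure (length_measure g) (portion (length_measure g) t R)"
      by (intro mult_right_mono) auto
    finally show ?thesis using that[of R] \<open>0 < R\<close> by simp
  next
    case False
    have "ennreal (2 * dist t z) = 2 * ennreal (dist t z)"
      by (simp add: ennreal_mult)
    also have "\<dots> \<le> 2 * emeasure (length_measure g) (portion (length_measure g) t (dist t z))"
      using emeasure_portion_ge[OF t z pos] by (intro mult_left_mono) auto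
    also have "\<dots> \<le> 2 * emeasure (length_measure g) (portion (length_measure g) t R)"
      using False by (intro mult_left_mono emeasure_mono portion_sets) (auto simp: portion_def)
    finally have "ennreal (2 * dist t z) \<le> 2 * emeasure (length_measure g) (portion (length_measure g) t R)" .
    moreover have "portion (length_measure g) t (2 * dist t z) = portion (length_measure g) t R"
      using far[THEN le_less_trans] False pos by (auto simp: portion_eq)
    ultimately show ?thesis using that[of "2 * dist t z"] pos by simp
  qed
qed

text \<open>Lets integrability over the whole curve be read off from a single portion.\<close>

lemma portion_eq_curve:
  obtains R where "0 < R" "portion (length_measure g) t R = path_image g"
proof -
  have "bounded (path_image g)"
    using jordan by (auto simp: rectifiable_jordan_curve_def bounded_simple_path_image)
  then obtain R where "path_image g \<subseteq> ball t R" "0 < R"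
    using bounded_subset_ballD by blast
  then show ?thesis using that[of R] by (auto simp: portion_eq)
qed

section \<open>Weights on a rectifiable Jordan curve\<close>

text \<open>The bound depends on the two Muckenhoupt constants but not on \<open>t\<close>, so it
  serves the pointwise and the uniform claim. The factor 2 in the comparable radius is squared to 4
  and then doubled by the oscillation estimate.\<close>

lemma bmo_seminorm_at_ln_bound:
  assumes norm: "banach_function_norm (length_measure g) \<rho>"
    and w: "weight (length_measure g) w" and t: "t \<in> path_image g"
    and a: "0 \<le> a" "\<And>R. 0 < R \<Longrightarrow> muckenhoupt_B (length_measure g) \<rho> t R w \<le> ennreal a"
    and b: "0 \<le> b" "\<And>R. 0 < R \<Longrightarrow> muckenhoupt_B (length_measure g) \<rho> t R (\<lambda>_. 1) \<le> ennreal b"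
  shows "bmo_seminorm_at (length_measure g) t (\<lambda>\<tau>. ln_ennreal (w \<tau>)) \<le> ennreal (8 * a * b)"
    and "(\<lambda>\<tau>. ln_ennreal (w \<tau>)) \<in> L1 (length_measure g)"
proof -
  define M where "M = length_measure g"
  interpret finite_measure M
    unfolding M_def by (rule finite_length_measure)
  have w_meas [measurable]: "w \<in> borel_measurable M"
    using w by (simp add: weight_def M_def)
  note osc = A2_mean_oscillation[OF w[folded M_def] portion_sets[of t, folded M_def], where K = "4 * a * b"]
  have A2: "(\<integral>\<^sup>+\<tau>\<in>portion M t R. w \<tau> \<partial>M) * (\<integral>\<^sup>+\<tau>\<in>portion M t R. 1 / w \<tau> \<partial>M)
      \<le> ennreal (4 * a * b) * emeasure M (portion M t R) ^ 2"
    and pos: "0 < emeasure M (portion M t R)" if "0 < R" for R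
  proof -
    from portion_comparable_radius[OF t that] obtain R' where R': "0 < R'"
      and eq: "portion M t R' = portion M t R"
      and le: "ennreal R' \<le> 2 * emeasure M (portion M t R)"
      unfolding M_def by blast
    have "0 < ennreal R'" using R' by simp
    with le have "0 < 2 * emeasure M (portion M t R)" by (rule less_le_trans[rotated])
    then show "0 < emeasure M (portion M t R)"
      by (simp add: ennreal_zero_less_mult_iff)
    \<comment> \<open>The estimate is made at \<open>R'\<close>, which the measure controls, and
      holds at \<open>R\<close> because the portions coincide.\<close>
    have "(\<integral>\<^sup>+\<tau>\<in>portion M t R'. w \<tau> \<partial>M) * (\<integral>\<^sup>+\<tau>\<in>portion M t R'. 1 / w \<tau> \<partial>M)
        \<le> ennreal R' ^ 2 * (muckenhoupt_B M \<rho> t R' w * muckenhoupt_B M \<rho> t R' (\<lambda>_. 1))"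
      unfolding M_def
      by (rule A2_product_le_muckenhoupt[OF norm w_meas[unfolded M_def] portion_sets R'])
    also have "\<dots> \<le> (2 * emeasure M (portion M t R)) ^ 2 * (ennreal a * ennreal b)"
      using a(2)[OF R'] b(2)[OF R'] by (intro mult_mono power_mono le) (auto simp: M_def)
    also have "\<dots> = ennreal (4 * a * b) * emeasure M (portion M t R) ^ 2"
      using a(1) b(1) by (simp add: ennreal_mult power_mult_distrib mult_ac)
    finally show "(\<integral>\<^sup>+\<tau>\<in>portion M t R. w \<tau> \<partial>M) * (\<integral>\<^sup>+\<tau>\<in>portion M t R. 1 / w \<tau> \<partial>M)
        \<le> ennreal (4 * a * b) * emeasure M (portion M t R) ^ 2"
      unfolding eq .
  qed
  have ab: "0 \<le> 4 * a * b" using a(1) b(1) by simp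
  have fin: "emeasure M (portion M t R) < \<infinity>" for R
    by (simp add: less_top[symmetric])
  show "bmo_seminorm_at (length_measure g) t (\<lambda>\<tau>. ln_ennreal (w \<tau>)) \<le> ennreal (8 * a * b)"
    unfolding bmo_seminorm_at_def M_def[symmetric]
  proof (rule SUP_least)
    fix R :: real
    assume "R \<in> {0<..}"
    then have R: "0 < R" by simp
    show "(\<integral>\<^sup>+\<tau>\<in>portion M t R. e2ennreal \<bar>ln_ennreal (w \<tau>) - ereal (mean M t (\<lambda>\<tau>. ln_ennreal (w \<tau>)) R)\<bar> \<partial>M)
        / emeasure M (portion M t R) \<le> ennreal (8 * a * b)"
      using osc(1)[OF pos[OF R] fin ab A2[OF R]]
      by (simp add: mean_def real_of_ereal_ln_ennreal mult.assoc)
  qed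
  obtain R where R: "0 < R" "portion M t R = space M"
    using portion_eq_curve[of t] by (auto simp: M_def space_length_measure)
  have "(\<integral>\<^sup>+\<tau>\<in>portion M t R. e2ennreal \<bar>ln_ennreal (w \<tau>)\<bar> \<partial>M) < \<infinity>"
    using osc(2)[OF pos[OF R(1)] fin ab A2[OF R(1)] refl] .
  moreover have "(\<integral>\<^sup>+\<tau>\<in>space M. e2ennreal \<bar>ln_ennreal (w \<tau>)\<bar> \<partial>M) = (\<integral>\<^sup>+\<tau>. e2ennreal \<bar>ln_ennreal (w \<tau>)\<bar> \<partial>M)"
    by (intro nn_integral_cong) simp
  ultimately show "(\<lambda>\<tau>. ln_ennreal (w \<tau>)) \<in> L1 (length_measure g)"
    by (simp add: L1_def R(2) flip: M_def)
qed

end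

section \<open>Real constants from the Muckenhoupt classes, and the conclusion\<close>

lemma A_class_at_bound:
  assumes "v \<in> A_class_at M \<rho> t"
  obtains a where "0 \<le> a" "\<And>R. 0 < R \<Longrightarrow> muckenhoupt_B M \<rho> t R v \<le> ennreal a"
proof
  let ?S = "SUP R\<in>{0<..}. muckenhoupt_B M \<rho> t R v"
  have "ennreal (enn2real ?S) = ?S"
    using assms by (simp add: A_class_at_def)
  then show "muckenhoupt_B M \<rho> t R v \<le> ennreal (enn2real ?S)" if "0 < R" for R
    using that by (auto intro: SUP_upper)
qed simp

lemma A_class_bound:
  assumes "v \<in> A_class M \<rho>"
  obtains a where "0 \<le> a"
    "\<And>t R. t \<in> space M \<Longrightarrow> 0 < R \<Longrightarrow> muckenhoupt_B M \<rho> t R v \<le> ennreal a"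
proof
  let ?S = "SUP t\<in>space M. SUP R\<in>{0<..}. muckenhoupt_B M \<rho> t R v"
  have "ennreal (enn2real ?S) = ?S"
    using assms by (simp add: A_class_def)
  then show "muckenhoupt_B M \<rho> t R v \<le> ennreal (enn2real ?S)" if "t \<in> space M" "0 < R" for t R
    using that by (auto intro!: SUP_upper2[of t] SUP_upper2[of R])
qed simp

theorem lemma3p2:
  fixes \<gamma> :: "real \<Rightarrow> complex"
    and \<rho> :: "(complex \<Rightarrow> ennreal) \<Rightarrow> ennreal"
    and w :: "complex \<Rightarrow> ennreal"
  assumes "rectifiable_jordan_curve \<gamma>"
    and "banach_function_norm (length_measure \<gamma>) \<rho>"
    and "weight (length_measure \<gamma>) w"
  shows "(\<forall>t\<in>path_image \<gamma>.
            w \<in> A_class_at (length_measure \<gamma>) \<rho> t \<longrightarrow>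
            (\<lambda>_. 1) \<in> A_class_at (length_measure \<gamma>) \<rho> t \<longrightarrow>
            (\<lambda>\<tau>. ln_ennreal (w \<tau>)) \<in> BMO_at (length_measure \<gamma>) t) \<and>
         (w \<in> A_class (length_measure \<gamma>) \<rho> \<longrightarrow>
          (\<lambda>_. 1) \<in> A_class (length_measure \<gamma>) \<rho> \<longrightarrow>
          (\<lambda>\<tau>. ln_ennreal (w \<tau>)) \<in> BMO (length_measure \<gamma>))"
proof (intro conjI ballI impI)
  let ?M = "length_measure \<gamma>" and ?f = "\<lambda>\<tau>. ln_ennreal (w \<tau>)"
  note bound = bmo_seminorm_at_ln_bound[OF assms]
  {
    fix t
    assume t: "t \<in> path_image \<gamma>"
      and A: "w \<in> A_class_at ?M \<rho> t" "(\<lambda>_. 1) \<in> A_class_at ?M \<rho> t"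
    obtain a where a: "0 \<le> a" "\<And>R. 0 < R \<Longrightarrow> muckenhoupt_B ?M \<rho> t R w \<le> ennreal a"
      using A_class_at_bound[OF A(1)] by blast
    obtain b where b: "0 \<le> b" "\<And>R. 0 < R \<Longrightarrow> muckenhoupt_B ?M \<rho> t R (\<lambda>_. 1) \<le> ennreal b"
      using A_class_at_bound[OF A(2)] by blast
    show "?f \<in> BMO_at ?M t"
      using bound[OF t a b] by (auto simp: BMO_at_def intro: le_less_trans)
  }
  assume A: "w \<in> A_class ?M \<rho>" "(\<lambda>_. 1) \<in> A_class ?M \<rho>"
  obtain a where a: "0 \<le> a"
    "\<And>t R. t \<in> path_image \<gamma> \<Longrightarrow> 0 < R \<Longrightarrow> muckenhoupt_B ?M \<rho> t R w \<le> ennreal a"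
    using A_class_bound[OF A(1)] unfolding space_length_measure[OF assms(1)] by blast
  obtain b where b: "0 \<le> b"
    "\<And>t R. t \<in> path_image \<gamma> \<Longrightarrow> 0 < R \<Longrightarrow> muckenhoupt_B ?M \<rho> t R (\<lambda>_. 1) \<le> ennreal b"
    using A_class_bound[OF A(2)] unfolding space_length_measure[OF assms(1)] by blast
  have "(SUP t\<in>space ?M. bmo_seminorm_at ?M t ?f) \<le> ennreal (8 * a * b)"
    using bound(1)[OF _ a(1) a(2) b(1) b(2)]
    by (intro SUP_least) (simp add: space_length_measure[OF assms(1)])
  \<comment> \<open>Membership in \<open>L1\<close> does not involve a base point, so the estimate
    at the starting point of the curve suffices.\<close>
  moreover have "?f \<in> L1 ?M"
    by (rule bound(2)[OF pathstart_in_path_image a(1) a(2)[OF pathstart_in_path_image]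
          b(1) b(2)[OF pathstart_in_path_image]])
  ultimately show "?f \<in> BMO ?M"
    by (auto simp: BMO_def intro: le_less_trans)
qed

end
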